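(* Let $SO(n)A_i$, $i=1,\dots,n$, be positive wells, and assume that there exists a set $\mathcal{C}=\{(i_k,j_k)\}_{k=1}^{n-1}$ of pairs of elements of $\{1,\dots,n\}$ such that $SO(n)A_{i_k}$ is rank-$1$ connected to $SO(n)A_{j_k}$ for every $k$. Assume moreover that for all $i,j\in\{1,\dots,n\}$ there exist $w_0=i,w_1,\dots,w_\ell=j$ in $\{1,\dots,n\}$ such that, for every $k\in\{0,\dots,\ell-1\}$, $(w_k,w_{k+1})\in\mathcal{C}$ or $(w_{k+1},w_k)\in\mathcal{C}$. For $k=1,\dots,n-1$ let $p_k,q_k\in\mathbb{R}^n$ be the vectors characterized (up to sign) by $$p_k\cdot q_k=0\quad\text{and}\quad A_{i_k}^TA_{i_k}-A_{j_k}^TA_{j_k}=p_kp_k^T-q_kq_k^T,$$ and assume that the collection $\{p_1,\dots,p_{n-1},q_1,\dots,q_{n-1}\}$ contains no linearly dependent subcollection of $n$ elements. Then for every $i\in\{1,\dots,n\}$ there exists $v_i\in S^{n-1}$ such that $$|A_iv_i|>|A_jv_i|\quad\text{for all } j\in\{1,\dots,n\},\ j\ne i.$$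
   Context: A well is a set $SO(n)A=\{QA:Q\in SO(n)\}$ with $A\in\mathbb{R}^{n\times n}$; it is positive if $\det A>0$. Two wells $SO(n)A$ and $SO(n)B$ are rank-$1$ connected if there exist $X\in SO(n)A$ and $Y\in SO(n)B$ with $\mathrm{rank}(X-Y)=1$. For two rank-$1$ connected positive wells, column vectors $p,q$ with $p\cdot q=0$ and $A^TA-B^TB=pp^T-qq^T$ always exist and are unique up to multiplication by $-1$ (one of them may vanish). The collection $\{p_1,\dots,p_{n-1},q_1,\dots,q_{n-1}\}$ is regarded as an indexed list of $2n-2$ vectors, so the condition says that any $n$ of them (with distinct positions in the list) are linearly independent. *)

theory Defs
  imports "HOL-Analysis.Analysis"
begin

definition well :: "real^'n^'n \<Rightarrow> (real^'n^'n) set" where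
  "well A = {Q ** A | Q. rotation_matrix Q}"

definition rank_one_connected :: "(real^'n^'n) set \<Rightarrow> (real^'n^'n) set \<Rightarrow> bool" where
  "rank_one_connected U V \<longleftrightarrow> (\<exists>X\<in>U. \<exists>Y\<in>V. rank (X - Y) = 1)"

definition outer_prod :: "real^'n \<Rightarrow> real^'n \<Rightarrow> real^'n^'n" where
  "outer_prod p q = (\<chi> a b. p $ a * q $ b)"

lemma outer_prod_eq: "outer_prod p q = columnvector p ** (rowvector q :: real^'n^1)"
  by (simp add: outer_prod_def columnvector_def rowvector_def matrix_matrix_mult_def)

(* Linear independence of an indexed family, as opposed to the library's notion for sets:
   a vector occurring at two different indices makes the family dependent. *)
definition independent_family :: "('i \<Rightarrow> 'a::real_vector) \<Rightarrow> 'i set \<Rightarrow> bool" where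
  "independent_family v J \<longleftrightarrow>
    (\<forall>c. (\<Sum>x\<in>J. c x *\<^sub>R v x) = 0 \<longrightarrow> (\<forall>x\<in>J. c x = 0))"

lemma independent_family_iff:
  assumes "finite J"
  shows "independent_family v J \<longleftrightarrow> inj_on v J \<and> independent (v ` J)"
proof
  assume L: "independent_family v J"
  have inj: "inj_on v J"
  proof (rule inj_onI, rule ccontr)
    fix x y assume xy: "x \<in> J" "y \<in> J" "v x = v y" "x \<noteq> y"
    define c where "c = (\<lambda>z. if z = x then 1 else if z = y then -1 else (0::real))"
    have "(\<Sum>z\<in>J. c z *\<^sub>R v z) = (\<Sum>z\<in>{x,y}. c z *\<^sub>R v z)"
      using xy assms by (intro sum.mono_neutral_right) (auto simp: c_def)
    also have "\<dots> = 0" using xy by (simp add: c_def)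
    finally have "c x = 0" using L xy(1) unfolding independent_family_def by blast
    then show False by (simp add: c_def)
  qed
  moreover have "independent (v ` J)"
    unfolding independent_explicit_finite_subsets
  proof (intro allI impI ballI)
    fix S u b assume S: "S \<subseteq> v ` J" "finite S" "(\<Sum>w\<in>S. u w *\<^sub>R w) = 0" "b \<in> S"
    define c where "c = (\<lambda>x. if v x \<in> S then u (v x) else 0)"
    have "(\<Sum>x\<in>J. c x *\<^sub>R v x) = (\<Sum>w\<in>v ` J. (if w \<in> S then u w else 0) *\<^sub>R w)"
      by (simp add: sum.reindex[OF inj] c_def)
    also have "\<dots> = (\<Sum>w\<in>S. u w *\<^sub>R w)"
      using S assms by (intro sum.mono_neutral_cong_right) auto
    finally have "\<forall>x\<in>J. c x = 0" using L S unfolding independent_family_def by auto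
    moreover obtain x where "x \<in> J" "b = v x" using S by blast
    ultimately have "c x = 0" by blast
    then show "u b = 0" using S(4) \<open>b = v x\<close> by (simp add: c_def)
  qed
  ultimately show "inj_on v J \<and> independent (v ` J)" ..
next
  assume R: "inj_on v J \<and> independent (v ` J)"
  show "independent_family v J"
    unfolding independent_family_def
  proof (intro allI impI ballI)
    fix c x assume c: "(\<Sum>x\<in>J. c x *\<^sub>R v x) = 0" "x \<in> J"
    let ?u = "\<lambda>w. c (the_inv_into J v w)"
    have "(\<Sum>w\<in>v ` J. ?u w *\<^sub>R w) = 0"
      using c R by (simp add: sum.reindex the_inv_into_f_f)
    moreover have all: "\<And>u. (\<Sum>w\<in>v ` J. u w *\<^sub>R w) = 0 \<Longrightarrow> \<forall>b\<in>v ` J. u b = 0"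
      using R assms unfolding independent_explicit_finite_subsets by blast
    ultimately have "\<forall>b\<in>v ` J. ?u b = 0" by (intro all)
    then have "?u (v x) = 0" using c(2) by blast
    then show "c x = 0" using R c(2) by (simp add: the_inv_into_f_f)
  qed
qed

end

theory Submission
  imports Defs
begin

text \<open>Root the graph at \<open>i\<close> and give every other vertex \<open>j\<close> an edge \<open>k\<close> leading to a vertex
  closer to \<open>i\<close>; different vertices get different edges. Along this edge
  \<open>|A_parent v|^2 - |A_j v|^2\<close> equals \<open>(p_k . v)^2 - (q_k . v)^2\<close> up to sign. Take a nonzero \<open>v\<close>
  orthogonal to the \<open>n - 1\<close> vectors entering negatively. By independence of any \<open>n\<close> of the
  vectors, \<open>v\<close> is orthogonal to none of those entering positively, so \<open>|A_j v|\<close> strictly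
  decreases when moving away from \<open>i\<close>.\<close>

text \<open>The function \<open>d\<close> is the length of a shortest \<open>R\<close>-path to
  \<open>i\<close>; the first step of such a path leaves a shorter one. Where no path exists the
  \<open>LEAST\<close> value carries no information, hence the premise of reachability.\<close>

lemma exists_closer_neighbour:
  fixes R :: "'a rel"
  obtains d :: "'a \<Rightarrow> nat"
  where "\<And>j. (j, i) \<in> R\<^sup>* \<Longrightarrow> j \<noteq> i \<Longrightarrow> \<exists>m. (j, m) \<in> R \<and> d m < d j"
proof
  let ?d = "\<lambda>j. LEAST l. (j, i) \<in> R ^^ l"
  fix j assume "(j, i) \<in> R\<^sup>*" "j \<noteq> i"
  then have "(j, i) \<in> R ^^ ?d j"
    using rtrancl_imp_relpow by (metis (mono_tags, lifting) LeastI)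
  moreover from this \<open>j \<noteq> i\<close> obtain l where l: "?d j = Suc l"
    by (cases "?d j") auto
  ultimately obtain m where m: "(j, m) \<in> R" "(m, i) \<in> R ^^ l"
    by (metis relpow_Suc_D2)
  then have "?d m < ?d j"
    using Least_le[of "\<lambda>l. (m, i) \<in> R ^^ l", OF m(2)] l by simp
  with m(1) show "\<exists>m. (j, m) \<in> R \<and> ?d m < ?d j" by blast
qed

text \<open>As many independent vectors as the dimension span the whole space, so \<open>u\<close>
  is orthogonal to itself.\<close>

lemma orthogonal_to_independent_family_imp_zero:
  fixes v :: "'i \<Rightarrow> 'a::euclidean_space"
  assumes "independent_family v J" "finite J" "card J = DIM('a)"
    and orth: "\<And>x. x \<in> J \<Longrightarrow> v x \<bullet> u = 0"
  shows "u = 0"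
proof -
  have "inj_on v J" "independent (v ` J)"
    using assms by (simp_all add: independent_family_iff)
  then have "UNIV \<subseteq> span (v ` J)"
    using assms(3) by (intro card_ge_dim_independent) (simp_all add: card_image)
  then have "orthogonal u u"
    using orth by (intro orthogonal_to_span[of u "v ` J"]) (auto simp: orthogonal_def inner_commute)
  then show ?thesis by (simp add: orthogonal_self)
qed

lemma outer_prod_mult_vec: "outer_prod p q *v v = (q \<bullet> v) *\<^sub>R p"
  by (simp add: vec_eq_iff outer_prod_def matrix_vector_mult_def inner_vec_def
      sum_distrib_left sum_distrib_right mult_ac)

lemma norm_matrix_vector_mult_power2:
  fixes A :: "real^'n^'m"
  shows "(norm (A *v v))\<^sup>2 = v \<bullet> ((transpose A ** A) *v v)"
  by (simp add: power2_norm_eq_inner dot_lmul_matrix[symmetric] matrix_vector_mul_assoc[symmetric]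
      matrix_transpose_mul flip: transpose_matrix_vector)

text \<open>Evaluate the quadratic forms of both sides of the premise at \<open>v\<close>; that of
  \<open>outer_prod p p\<close> is \<open>(p \<bullet> v)\<^sup>2\<close>.\<close>

lemma norm_power2_diff_outer_prod:
  fixes A B :: "real^'n^'n"
  assumes "transpose A ** A - transpose B ** B = outer_prod p p - outer_prod q q"
  shows "(norm (A *v v))\<^sup>2 - (norm (B *v v))\<^sup>2 = (p \<bullet> v)\<^sup>2 - (q \<bullet> v)\<^sup>2"
proof -
  have "(norm (A *v v))\<^sup>2 - (norm (B *v v))\<^sup>2
      = v \<bullet> ((transpose A ** A - transpose B ** B) *v v)"
    by (simp add: norm_matrix_vector_mult_power2 matrix_vector_mult_diff_rdistrib inner_diff_right)
  then show ?thesis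
    by (simp add: assms matrix_vector_mult_diff_rdistrib outer_prod_mult_vec inner_diff_right
        power2_eq_square inner_commute)
qed

theorem theorem2:
  fixes A :: "nat \<Rightarrow> real^'n^'n"
    and n :: nat
    and s t :: "nat \<Rightarrow> nat"
    and C :: "(nat \<times> nat) set"
    and p q :: "nat \<Rightarrow> real^'n"
  assumes n: "n = CARD('n)"
    and positive: "\<And>i. i \<in> {1..n} \<Longrightarrow> det (A i) > 0"
    and C: "C = {(s k, t k) | k. k \<in> {1..n-1}}" "C \<subseteq> {1..n} \<times> {1..n}"
    and rank_one: "\<And>k. k \<in> {1..n-1} \<Longrightarrow> rank_one_connected (well (A (s k))) (well (A (t k)))"
    and path: "\<And>i j. i \<in> {1..n} \<Longrightarrow> j \<in> {1..n} \<Longrightarrow>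
      \<exists>(l::nat) (w::nat \<Rightarrow> nat). w 0 = i \<and> w l = j \<and> (\<forall>k\<in>{0..l}. w k \<in> {1..n}) \<and>
        (\<forall>k\<in>{0..<l}. (w k, w (k+1)) \<in> C \<or> (w (k+1), w k) \<in> C)"
    and orth: "\<And>k. k \<in> {1..n-1} \<Longrightarrow> p k \<bullet> q k = 0"
    and diff: "\<And>k. k \<in> {1..n-1} \<Longrightarrow>
      transpose (A (s k)) ** A (s k) - transpose (A (t k)) ** A (t k)
        = outer_prod (p k) (p k) - outer_prod (q k) (q k)"
    and indep: "\<And>J. J \<subseteq> {1..n-1} <+> {1..n-1} \<Longrightarrow> card J = n \<Longrightarrow>
      independent_family (case_sum p q) J"
  shows "\<forall>i\<in>{1..n}. \<exists>v\<in>sphere 0 1. \<forall>j\<in>{1..n}. j \<noteq> i \<longrightarrow> norm (A i *v v) > norm (A j *v v)"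
proof
  fix i assume i: "i \<in> {1..n}"
  define R where "R = C \<union> C\<inverse>"
  define V where "V = {1..n} - {i}"
  have conn: "(j, i) \<in> R\<^sup>*" if j: "j \<in> {1..n}" for j
  proof -
    obtain l :: nat and w where "w 0 = j" "w l = i"
      "\<And>k. k < l \<Longrightarrow> (w k, w (Suc k)) \<in> R"
      using path[OF j i] by (auto simp: R_def)
    then have "(j, i) \<in> R ^^ l" by (auto simp: relpow_fun_conv)
    then show ?thesis by (rule relpow_imp_rtrancl)
  qed
  obtain d :: "nat \<Rightarrow> nat" where
    d: "\<And>j. (j, i) \<in> R\<^sup>* \<Longrightarrow> j \<noteq> i \<Longrightarrow> \<exists>m. (j, m) \<in> R \<and> d m < d j"
    using exists_closer_neighbour[of i R] by metis
  have "\<exists>k m. k \<in> {1..n-1} \<and> m \<in> {1..n} \<and> d m < d j \<and> (s k = m \<and> t k = j \<or> s k = j \<and> t k = m)"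
    if "j \<in> V" for j
  proof -
    obtain m where "(j, m) \<in> R" "d m < d j"
      using d conn \<open>j \<in> V\<close> by (auto simp: V_def)
    moreover from this(1) obtain k where "k \<in> {1..n-1}" "s k = m \<and> t k = j \<or> s k = j \<and> t k = m"
      using C(1) by (auto simp: R_def)
    moreover have "m \<in> {1..n}" using \<open>(j, m) \<in> R\<close> C(2) by (auto simp: R_def)
    ultimately show ?thesis by blast
  qed
  \<comment> \<open>Here \<open>m j\<close> is the parent of \<open>j\<close> and \<open>e j\<close>
    the edge joining them. The order of the pair in \<open>C\<close> is unrelated to the root, hence
    two cases in \<open>ends\<close>.\<close>
  then obtain e m where e: "\<And>j. j \<in> V \<Longrightarrow> e j \<in> {1..n-1}"
    and m: "\<And>j. j \<in> V \<Longrightarrow> m j \<in> {1..n}" "\<And>j. j \<in> V \<Longrightarrow> d (m j) < d j"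
    and ends: "\<And>j. j \<in> V \<Longrightarrow> s (e j) = m j \<and> t (e j) = j \<or> s (e j) = j \<and> t (e j) = m j"
    by metis
  \<comment> \<open>Two different vertices sharing an edge would be each other's parents, and each
    would be strictly closer to \<open>i\<close> than the other.\<close>
  have e_inj: "j = j'" if "j \<in> V" "j' \<in> V" "e j = e j'" for j j'
  proof (rule ccontr)
    assume "j \<noteq> j'"
    then have "m j = j'" "m j' = j" using that ends[of j] ends[of j'] by auto
    then show False using m(2)[of j] m(2)[of j'] that by simp
  qed
  \<comment> \<open>Positions in the list of vectors are elements of a disjoint sum:
    \<open>Inl k\<close> stands for \<open>p k\<close>, \<open>Inr k\<close> for \<open>q k\<close>.
    If the parent is \<open>s (e j)\<close>, then \<open>p\<close> enters with sign plus and
    \<open>q\<close> with minus; otherwise the roles are swapped.\<close>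
  define neg where "neg j = (if s (e j) = m j then Inr (e j) else Inl (e j))" for j
  define pos where "pos j = (if s (e j) = m j then Inl (e j) else Inr (e j))" for j
  let ?x = "case_sum p q"
  have sq_diff: "(norm (A (m j) *v v))\<^sup>2 - (norm (A j *v v))\<^sup>2
      = (?x (pos j) \<bullet> v)\<^sup>2 - (?x (neg j) \<bullet> v)\<^sup>2" if "j \<in> V" for j v
    using ends[OF that] norm_power2_diff_outer_prod[OF diff[OF e[OF that]], of v]
    by (auto simp: neg_def pos_def)
  have neg_inj: "inj_on neg V"
    by (rule inj_onI) (auto simp: neg_def e_inj split: if_splits)
  have card_V: "finite V" "card V = n - 1" using i by (auto simp: V_def)
  \<comment> \<open>At most \<open>n - 1\<close> vectors span a proper subspace, so some nonzero
    \<open>u\<close> is orthogonal to all of them.\<close>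
  have "dim (?x ` neg ` V) \<le> n - 1"
    using dim_le_card'[of "?x ` neg ` V"] card_image_le[of V "\<lambda>j. ?x (neg j)"] card_V
    by (simp add: image_image)
  also have "\<dots> < DIM(real^'n)" using i n by auto
  finally obtain u where u: "u \<noteq> 0" "\<And>y. y \<in> span (?x ` neg ` V) \<Longrightarrow> orthogonal u y"
    using orthogonal_to_subspace_exists by blast
  have neg_zero: "?x y \<bullet> u = 0" if "y \<in> neg ` V" for y
    using u(2)[of "?x y"] that by (simp add: span_base orthogonal_def inner_commute)
  have pos_nonzero: "?x (pos j) \<bullet> u \<noteq> 0" if j: "j \<in> V" for j
  proof
    assume zero: "?x (pos j) \<bullet> u = 0"
    \<comment> \<open>If \<open>pos j = neg j'\<close>, both carry the same edge, so
      \<open>j = j'\<close>; but \<open>pos j\<close> and \<open>neg j\<close> lie in different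
      summands. Adding \<open>pos j\<close> thus yields exactly \<open>n\<close> positions, to which
      \<open>indep\<close> applies.\<close>
    have "pos j \<notin> neg ` V"
      using e_inj[OF j] by (auto simp: pos_def neg_def split: if_splits)
    then have card: "card (insert (pos j) (neg ` V)) = n"
      using card_V neg_inj i by (simp add: card_image)
    have "insert (pos j) (neg ` V) \<subseteq> {1..n-1} <+> {1..n-1}"
      using e j by (auto simp: pos_def neg_def)
    then have "independent_family ?x (insert (pos j) (neg ` V))"
      using card by (rule indep)
    then have "u = 0"
      using card card_V zero neg_zero n
      by (intro orthogonal_to_independent_family_imp_zero[of ?x "insert (pos j) (neg ` V)"]) auto
    with u(1) show False by simp
  qed
  have step: "norm (A j *v u) < norm (A (m j) *v u)" if j: "j \<in> V" for j
  proof (rule power_less_imp_less_base)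
    have "(norm (A (m j) *v u))\<^sup>2 - (norm (A j *v u))\<^sup>2 = (?x (pos j) \<bullet> u)\<^sup>2"
      using sq_diff[OF j, of u] neg_zero[OF imageI[OF j]] by simp
    also have "\<dots> > 0" using pos_nonzero[OF j] by simp
    finally show "(norm (A j *v u))\<^sup>2 < (norm (A (m j) *v u))\<^sup>2" by simp
  qed simp
  have less: "norm (A j *v u) < norm (A i *v u)" if "j \<in> V" for j
    using that
  \<comment> \<open>Induction on the distance to the root: \<open>step\<close> compares
    \<open>j\<close> with its parent, and the induction hypothesis compares the parent with
    \<open>i\<close> unless they coincide.\<close>
  proof (induction "d j" arbitrary: j rule: less_induct)
    case less
    show ?case
    proof (cases "m j = i")
      case True
      then show ?thesis using step[OF less.prems] by simp
    next
      case False
      then have "m j \<in> V" using m(1)[OF less.prems] by (simp add: V_def)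
      then show ?thesis
        using less.hyps[OF m(2)[OF less.prems]] step[OF less.prems] by simp
    qed
  qed
  show "\<exists>v\<in>sphere 0 1. \<forall>j\<in>{1..n}. j \<noteq> i \<longrightarrow> norm (A i *v v) > norm (A j *v v)"
  proof (intro bexI ballI impI)
    \<comment> \<open>Scaling by a positive factor preserves the strict inequalities, so
      \<open>u\<close> may be normalised.\<close>
    show "(1 / norm u) *\<^sub>R u \<in> sphere 0 1" using u(1) by simp
    fix j assume "j \<in> {1..n}" "j \<noteq> i"
    then show "norm (A i *v ((1 / norm u) *\<^sub>R u)) > norm (A j *v ((1 / norm u) *\<^sub>R u))"
      using less[of j] u(1) by (simp add: V_def matrix_vector_mult_scaleR divide_strict_right_mono)
  qed
qed

end
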